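(* Let $k$ be a positive integer and $\beta \ge \alpha > 0$. There is $\varepsilon_0>0$ such that the following holds for every $0<\varepsilon\le\varepsilon_0$. Set $\delta = \frac{\varepsilon}{2}\left(\frac{\alpha}{16\beta}\right)^{2k}$, let $n>0$ and let $N \le \beta n$ be a positive integer. Suppose that $G$ is a $k$-coloured graph on at least $N + \varepsilon n$ vertices in which every vertex has at most $\delta n$ non-neighbours, and $G$ contains no monochromatic connected matching on at least $\alpha n$ vertices. Then there exists a $k$-colouring $G'$ of $K_N$ that contains no monochromatic connected matching on at least $\alpha n$ vertices. Moreover, there exists such a $G'$ containing an induced subgraph of $G$ on $N$ vertices, i.e. $V(G')$ is a set $S\subseteq V(G)$ of size $N$ and every edge of $G[S]$ has in $G'$ the colour it has in $G$.
   Context: A $k$-coloured graph is a graph each of whose edges is assigned one of $k$ colours; a $k$-colouring of $K_N$ is such an assignment on the complete graph. For a colour $\ell$, an $\ell$-coloured component is a connected component of the graph formed by the edges of colour $\ell$. A monochromatic connected matching is a matching all of whose edges have the same colour $\ell$ and lie in a single $\ell$-coloured component; it is on at least $t$ vertices if it covers at least $t$ vertices. *)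

theory Defs
  imports Complex_Main
begin

definition complete_edges :: "'a set \<Rightarrow> 'a set set" where
  "complete_edges V = {e. e \<subseteq> V \<and> card e = 2}"

definition simple_graph :: "'a set \<Rightarrow> 'a set set \<Rightarrow> bool" where
  "simple_graph V E \<longleftrightarrow> finite V \<and> E \<subseteq> complete_edges V"

text \<open>The values of the colouring outside the edge set are irrelevant.\<close>

definition coloured_graph :: "nat \<Rightarrow> 'a set \<Rightarrow> 'a set set \<Rightarrow> ('a set \<Rightarrow> nat) \<Rightarrow> bool" where
  "coloured_graph k V E c \<longleftrightarrow> simple_graph V E \<and> (\<forall>e\<in>E. c e \<in> {1..k})"

definition colour_class :: "'a set set \<Rightarrow> ('a set \<Rightarrow> nat) \<Rightarrow> nat \<Rightarrow> 'a set set" where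
  "colour_class E c l = {e \<in> E. c e = l}"

definition adj :: "'a set set \<Rightarrow> ('a \<times> 'a) set" where
  "adj F = {(u, v). {u, v} \<in> F}"

definition graph_components :: "'a set \<Rightarrow> 'a set set \<Rightarrow> 'a set set" where
  "graph_components V F = {{u \<in> V. (v, u) \<in> (adj F)\<^sup>*} | v. v \<in> V}"

text \<open>A vertex does not count as a non-neighbour of itself.\<close>

definition non_neighbours :: "'a set \<Rightarrow> 'a set set \<Rightarrow> 'a \<Rightarrow> 'a set" where
  "non_neighbours V E v = {u \<in> V. u \<noteq> v \<and> {u, v} \<notin> E}"

definition matching :: "'a set set \<Rightarrow> 'a set set \<Rightarrow> bool" where
  "matching F M \<longleftrightarrow> M \<subseteq> F \<and> pairwise disjnt M"

definition mono_connected_matching ::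
  "'a set \<Rightarrow> 'a set set \<Rightarrow> ('a set \<Rightarrow> nat) \<Rightarrow> 'a set set \<Rightarrow> bool" where
  "mono_connected_matching V E c M \<longleftrightarrow>
     (\<exists>l. matching (colour_class E c l) M \<and>
        (\<exists>C \<in> graph_components V (colour_class E c l). \<forall>e\<in>M. e \<subseteq> C))"

definition has_mono_connected_matching ::
  "'a set \<Rightarrow> 'a set set \<Rightarrow> ('a set \<Rightarrow> nat) \<Rightarrow> real \<Rightarrow> bool" where
  "has_mono_connected_matching V E c t \<longleftrightarrow>
     (\<exists>M. mono_connected_matching V E c M \<and> real (card (\<Union>M)) \<ge> t)"

end

theory Submission
  imports Defs "HOL-Library.FuncSet"
begin

text \<open>Enlarge each colour class to an edge-maximal graph \<open>F\<^sub>l\<close> on \<open>V\<close> without a large connected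
  matching. As in Lovasz's proof of Tutte's theorem, every component of \<open>F\<^sub>l\<close> then consists of
  vertices adjacent to the whole component and of disjoint cliques. It suffices to find \<open>N\<close>
  vertices every two of which are adjacent in some \<open>F\<^sub>l\<close>.

  Non-adjacency in \<open>F\<^sub>l\<close> is the support of a matrix of rank at most \<open>4\<close>, so the pairs adjacent
  in no \<open>F\<^sub>l\<close> form the support of a matrix of rank at most \<open>4\<^sup>k\<close> (compare Alon's bound on covering
  graphs by equivalence relations). These pairs are non-edges of \<open>G\<close>, so every column has at
  most \<open>\<delta>n\<close> nonzero entries, and a matrix of rank \<open>r\<close> of this kind has at most \<open>r\<delta>n\<close> nonzero
  rows. Deleting these \<open>4\<^sup>k\<delta>n \<le> \<epsilon>n\<close> vertices leaves enough room.\<close>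

section \<open>Matchings and Gallai's exchange argument\<close>

lemma card_Union_matching:
  assumes "finite F" "\<And>e. e \<in> F \<Longrightarrow> card e = 2" "matching F M"
  shows "card (\<Union>M) = 2 * card M"
proof -
  have sub: "M \<subseteq> F" and disj: "pairwise disjnt M"
    using assms(3) by (auto simp: matching_def)
  have "card (\<Union>M) = sum card M"
    using disj
  proof (rule card_Union_disjoint)
    show "finite A" if "A \<in> M" for A
      using assms(2)[of A] sub that by (intro card_ge_0_finite) auto
  qed
  also have "\<dots> = sum (\<lambda>_. 2) M"
    using sub assms(2) by (intro sum.cong) auto
  finally show ?thesis by simp
qed

lemma matching_insert:
  assumes "matching F M" "e \<in> F" "e \<inter> \<Union>M = {}"
  shows "matching F (insert e M)"
  using assms unfolding matching_def pairwise_insert by (auto simp: disjnt_def)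

lemma matching_subset:
  assumes "matching F M" "M' \<subseteq> M"
  shows "matching F M'"
  using assms unfolding matching_def by (meson pairwise_subset subset_trans)

text \<open>The exchange argument of Gallai's lemma.\<close>

lemma max_matching_exchange:
  assumes fin: "finite F" and two: "\<And>e. e \<in> F \<Longrightarrow> card e = 2"
    and max: "\<And>M. matching F M \<Longrightarrow> card M \<le> s"
    and ab: "{a, b} \<in> F" and bc: "{b, c} \<in> F" and "a \<noteq> c"
    and M: "matching F M" "card M = s" "a \<notin> \<Union>M" "c \<notin> \<Union>M"
    and N: "matching F N" "card N = s" "b \<notin> \<Union>N"
  shows False
proof -
  have finm: "finite K" if "matching F K" for K
    using that fin finite_subset unfolding matching_def by blast
  have no_ext: "e \<inter> \<Union>K \<noteq> {}" if "matching F K" "card K = s" "e \<in> F" for K e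
  proof
    assume *: "e \<inter> \<Union>K = {}"
    have "e \<noteq> {}" using two[OF that(3)] by auto
    then have "e \<notin> K" using * by auto
    then have "card (insert e K) = Suc s" using finm[OF that(1)] that(2) by simp
    then show False using max[OF matching_insert[OF that(1,3) *]] by simp
  qed
  \<comment> \<open>Among the matchings of size \<open>s\<close> missing \<open>b\<close>,
    \<open>K\<close> shares the most edges with \<open>M\<close>; the contradiction will be one
    sharing more.\<close>
  define Q where "Q = (\<lambda>K. matching F K \<and> card K = s \<and> b \<notin> \<Union>K)"
  have "\<forall>K. Q K \<longrightarrow> card (M \<inter> K) < Suc s"
    using finm[OF M(1)] M(2) by (metis card_mono inf_le1 less_Suc_eq_le)
  then obtain K where K: "Q K" and best: "\<And>K'. Q K' \<Longrightarrow> card (M \<inter> K') \<le> card (M \<inter> K)"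
    using ex_has_greatest_nat[of Q N "\<lambda>K. card (M \<inter> K)" "Suc s"] N Q_def by blast
  have Km: "matching F K" "card K = s" "b \<notin> \<Union>K" using K Q_def by auto
  have "b \<in> \<Union>M" using no_ext[OF M(1,2) ab] M(3) by auto
  have "a \<in> \<Union>K" using no_ext[OF Km(1,2) ab] Km(3) by auto
  have "c \<in> \<Union>K" using no_ext[OF Km(1,2) bc] Km(3) by auto
  have cM: "card (\<Union>M) = 2 * s" and cK: "card (\<Union>K) = 2 * s"
    using card_Union_matching[OF fin two] M Km by auto
  have "s > 0"
  proof (rule ccontr)
    assume "\<not> s > 0"
    then have "M = {}" using M(2) finm[OF M(1)] by simp
    then show False using \<open>b \<in> \<Union>M\<close> by simp
  qed
  then have fU: "finite (\<Union>M)" "finite (\<Union>K)" using cM cK by (simp_all add: card_ge_0_finite)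
  \<comment> \<open>Both matchings cover \<open>2 * s\<close> vertices. If \<open>K\<close> covered
    all that \<open>M\<close> covers except \<open>b\<close>, then together with \<open>a\<close>
    and \<open>c\<close>, which \<open>M\<close> misses, it would cover
    \<open>2 * s + 1\<close>.\<close>
  have "\<not> \<Union>M - {b} \<subseteq> \<Union>K"
  proof
    assume "\<Union>M - {b} \<subseteq> \<Union>K"
    then have "(\<Union>M - {b}) \<union> {a, c} \<subseteq> \<Union>K"
      using \<open>a \<in> \<Union>K\<close> \<open>c \<in> \<Union>K\<close> by auto
    then have le: "card ((\<Union>M - {b}) \<union> {a, c}) \<le> 2 * s"
      using cK fU(2) card_mono by metis
    have "card ((\<Union>M - {b}) \<union> {a, c}) = card (\<Union>M - {b}) + card {a, c}"
      using M(3,4) fU(1) by (intro card_Un_disjoint) auto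
    also have "\<dots> = 2 * s - 1 + 2"
      using \<open>a \<noteq> c\<close> \<open>b \<in> \<Union>M\<close> cM fU(1) by (simp del: Union_iff)
    finally show False using le \<open>s > 0\<close> by simp
  qed
  then obtain x e where x: "x \<noteq> b" "x \<notin> \<Union>K" "x \<in> e" "e \<in> M" by blast
  have eF: "e \<in> F" using x(4) M(1) unfolding matching_def by auto
  obtain y where y: "e = {x, y}" "y \<noteq> x"
    using two[OF eF] x(3) unfolding card_2_iff by auto
  \<comment> \<open>Otherwise \<open>e\<close> could be added to \<open>K\<close>. Replacing the
    edge \<open>f\<close> of \<open>K\<close> at \<open>y\<close> by \<open>e\<close> keeps the size
    and still misses \<open>b\<close>; as \<open>f\<close> is not in \<open>M\<close>, the overlap
    with \<open>M\<close> grows.\<close>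
  have "y \<in> \<Union>K" using no_ext[OF Km(1,2) eF] x(2) y(1) by auto
  then have "y \<noteq> b" using Km(3) by auto
  obtain f where f: "f \<in> K" "y \<in> f" using \<open>y \<in> \<Union>K\<close> by auto
  have "f \<notin> M"
  proof
    assume "f \<in> M"
    moreover have "\<not> disjnt f e" using f(2) y(1) by (auto simp: disjnt_def)
    ultimately have "f = e"
      using M(1) x(4) unfolding matching_def pairwise_def by auto
    then show False using f(1) x(2,3) by blast
  qed
  define K' where "K' = insert e (K - {f})"
  have eK: "e \<inter> \<Union>(K - {f}) = {}"
  proof -
    have "y \<notin> \<Union>(K - {f})"
      using Km(1) f unfolding matching_def pairwise_def disjnt_def by blast
    then show ?thesis using x(2) y(1) by auto
  qed
  have "e \<notin> K" using x by blast
  have "Q K'"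
    unfolding Q_def
  proof (intro conjI)
    show "matching F K'"
      unfolding K'_def using matching_insert[OF matching_subset[OF Km(1)] eF eK] by blast
    show "card K' = s"
      unfolding K'_def using \<open>e \<notin> K\<close> f(1) finm[OF Km(1)] Km(2) \<open>s > 0\<close> by simp
    show "b \<notin> \<Union>K'"
      unfolding K'_def using y(1) x(1) \<open>y \<noteq> b\<close> Km(3) by auto
  qed
  have "M \<inter> K' = insert e (M \<inter> K)" unfolding K'_def using x(4) \<open>f \<notin> M\<close> by auto
  then have "card (M \<inter> K') = Suc (card (M \<inter> K))"
    using \<open>e \<notin> K\<close> finm[OF M(1)] by simp
  then show False using best[OF \<open>Q K'\<close>] by simp
qed

section \<open>Connected matchings and the structure of saturated graphs\<close>

text \<open>Stated for a single edge set because the saturated graphs of different colours may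
  overlap and need not form a colouring.\<close>

definition connected_matching :: "'a set \<Rightarrow> 'a set set \<Rightarrow> 'a set set \<Rightarrow> bool" where
  "connected_matching V F M \<longleftrightarrow>
     matching F M \<and> (\<exists>C \<in> graph_components V F. \<forall>e\<in>M. e \<subseteq> C)"

definition no_large_connected_matching :: "'a set \<Rightarrow> 'a set set \<Rightarrow> real \<Rightarrow> bool" where
  "no_large_connected_matching V F t \<longleftrightarrow>
     (\<forall>M. connected_matching V F M \<longrightarrow> real (card (\<Union>M)) < t)"

text \<open>The new edge joins vertices that are already connected, so no components merge.
  Saturation can thus be exploited inside one component of the old graph.\<close>

lemma adj_insert_same_component:
  assumes "(u, v) \<in> (adj F)\<^sup>*"
  shows "(adj (insert {u, v} F))\<^sup>* = (adj F)\<^sup>*"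
proof -
  have "sym (adj F)" by (auto simp: sym_def adj_def insert_commute)
  then have "(v, u) \<in> (adj F)\<^sup>*" using assms sym_rtrancl by (metis symD)
  then have "adj (insert {u, v} F) \<subseteq> (adj F)\<^sup>*"
    using assms by (auto simp: adj_def doubleton_eq_iff)
  moreover have "adj F \<subseteq> adj (insert {u, v} F)" by (auto simp: adj_def)
  ultimately show ?thesis by (rule rtrancl_subset[rotated])
qed

lemma connected_matching_mono:
  assumes "connected_matching S F M" "S \<subseteq> V" "F \<subseteq> F'"
  shows "connected_matching V F' M"
proof -
  have "(adj F)\<^sup>* \<subseteq> (adj F')\<^sup>*" using assms(3) by (intro rtrancl_mono) (auto simp: adj_def)
  moreover obtain v where v: "v \<in> S" "\<forall>e\<in>M. e \<subseteq> {u \<in> S. (v, u) \<in> (adj F)\<^sup>*}"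
    using assms(1) unfolding connected_matching_def graph_components_def by auto
  ultimately have "\<forall>e\<in>M. e \<subseteq> {u \<in> V. (v, u) \<in> (adj F')\<^sup>*}" using assms(2) by blast
  then show ?thesis
    using assms v(1) unfolding connected_matching_def graph_components_def matching_def by blast
qed

locale saturated_graph =
  fixes V :: "'a set" and F :: "'a set set" and t :: real
  assumes graph: "simple_graph V F"
    and no_large: "no_large_connected_matching V F t"
    and saturated: "\<And>e. e \<in> complete_edges V \<Longrightarrow> e \<notin> F \<Longrightarrow> \<not> no_large_connected_matching V (insert e F) t"
begin

definition component :: "'a \<Rightarrow> 'a set" where
  "component v = {u \<in> V. (v, u) \<in> (adj F)\<^sup>*}"

text \<open>Counterpart, component by component, of the vertices joined to all others in Lovasz's
  proof.\<close>

definition universal :: "'a \<Rightarrow> bool" where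
  "universal v \<longleftrightarrow> (\<forall>u \<in> component v. u \<noteq> v \<longrightarrow> {u, v} \<in> F)"

lemma finV: "finite V" and F_sub: "F \<subseteq> complete_edges V"
  using graph by (auto simp: simple_graph_def)

lemma finF: "finite F"
  using finite_subset[OF F_sub] finV by (simp add: complete_edges_def)

lemma edge_card: "e \<in> F \<Longrightarrow> card e = 2"
  using F_sub by (auto simp: complete_edges_def)

lemma edge_verts: "{u, v} \<in> F \<Longrightarrow> u \<in> V \<and> v \<in> V \<and> u \<noteq> v"
  using F_sub by (auto simp: complete_edges_def card_2_iff)

lemma reach_sym: "(u, v) \<in> (adj F)\<^sup>* \<Longrightarrow> (v, u) \<in> (adj F)\<^sup>*"
  by (metis (mono_tags, lifting) adj_def case_prodD case_prodI insert_commute mem_Collect_eq symD symI sym_rtrancl)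

lemma component_eq_iff:
  assumes "u \<in> V" "v \<in> V"
  shows "component u = component v \<longleftrightarrow> (u, v) \<in> (adj F)\<^sup>*"
proof
  assume "component u = component v"
  moreover have "v \<in> component v" using assms by (simp add: component_def)
  ultimately show "(u, v) \<in> (adj F)\<^sup>*" by (auto simp: component_def)
next
  assume "(u, v) \<in> (adj F)\<^sup>*"
  then show "component u = component v"
    using reach_sym by (auto simp: component_def intro: rtrancl_trans)
qed

lemma edge_component: "{u, v} \<in> F \<Longrightarrow> component u = component v"
  using component_eq_iff edge_verts by (metis adj_def case_prodI mem_Collect_eq r_into_rtrancl)

text \<open>By saturation, adding \<open>{u, v}\<close> creates a connected matching on at least
  \<open>t\<close> vertices, which must use this edge. Dropping the edge leaves \<open>M\<close>
  with \<open>2 * card M + 2 \<ge> t\<close>, so a larger matching in the component would itself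
  cover at least \<open>t\<close> vertices.\<close>

lemma missing_matching:
  assumes "w \<in> V" "u \<in> component w" "v \<in> component w" "u \<noteq> v" "{u, v} \<notin> F"
  defines "FC \<equiv> {e \<in> F. e \<subseteq> component w}"
  obtains M where "matching FC M" "u \<notin> \<Union>M" "v \<notin> \<Union>M"
    "\<And>M'. matching FC M' \<Longrightarrow> card M' \<le> card M"
proof -
  have uv: "u \<in> V" "v \<in> V" using assms by (auto simp: component_def)
  have reach: "(u, v) \<in> (adj F)\<^sup>*"
    using assms reach_sym by (auto simp: component_def intro: rtrancl_trans)
  have uvC: "{u, v} \<in> complete_edges V" using uv assms(4) by (simp add: complete_edges_def)
  obtain M' where M': "connected_matching V (insert {u, v} F) M'" "real (card (\<Union>M')) \<ge> t"
    using saturated[OF uvC assms(5)] unfolding no_large_connected_matching_def by force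
  have gc: "graph_components V (insert {u, v} F) = graph_components V F"
    using adj_insert_same_component[OF reach] by (simp add: graph_components_def)
  have mM': "matching (insert {u, v} F) M'" using M' by (simp add: connected_matching_def)
  obtain C where C: "C \<in> graph_components V F" "\<forall>e\<in>M'. e \<subseteq> C"
    using M' unfolding connected_matching_def gc by auto
  have uvM: "{u, v} \<in> M'"
  proof (rule ccontr)
    assume "{u, v} \<notin> M'"
    then have "connected_matching V F M'"
      using mM' C unfolding connected_matching_def matching_def by auto
    then show False using no_large M'(2) unfolding no_large_connected_matching_def by force
  qed
  obtain x where x: "x \<in> V" "C = component x"
    using C(1) by (auto simp: graph_components_def component_def)
  have "u \<in> component x" using C(2) uvM x by auto
  then have "component x = component w"
    using x(1) assms(1,2) uv component_eq_iff by (metis (mono_tags, lifting) component_def mem_Collect_eq)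
  then have Cw: "C = component w" using x by simp
  define M where "M = M' - {{u, v}}"
  have mM: "matching FC M"
    using mM' C(2) Cw pairwise_subset[of disjnt M' M] unfolding FC_def M_def matching_def by blast
  have disj: "u \<notin> \<Union>M" "v \<notin> \<Union>M"
    using mM' uvM unfolding M_def matching_def pairwise_def disjnt_def by fast+
  have finFC: "finite FC" unfolding FC_def using finF by simp
  have two: "card e = 2" if "e \<in> insert {u, v} F" for e
    using that edge_card assms(4) by auto
  have "card (\<Union>M') = 2 * card M'"
    using card_Union_matching[OF _ two mM'] finF by simp
  moreover have "card M' = Suc (card M)"
    unfolding M_def using uvM mM' finF
    by (metis card.remove finite_insert finite_subset matching_def)
  ultimately have tle: "t \<le> 2 * real (card M) + 2" using M'(2) by simp
  have "card K \<le> card M" if K: "matching FC K" for K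
  proof -
    have "connected_matching V F K"
      using K assms(1) unfolding connected_matching_def matching_def FC_def graph_components_def component_def
      by blast
    then have "real (card (\<Union>K)) < t" using no_large unfolding no_large_connected_matching_def by blast
    moreover have "card (\<Union>K) = 2 * card K"
      using card_Union_matching[OF finFC _ K] edge_card FC_def by auto
    ultimately show ?thesis using tle by simp
  qed
  then show ?thesis using that mM disj by blast
qed

text \<open>If \<open>{a, c}\<close> were missing, some maximum matching of the component would
  avoid \<open>a\<close> and \<open>c\<close>; a vertex \<open>d\<close> not adjacent to
  \<open>b\<close> gives another one avoiding \<open>b\<close>. The exchange lemma excludes this.
  Hence the non-universal vertices split into disjoint cliques.\<close>

lemma adjacency_transitive:
  assumes ab: "{a, b} \<in> F" and bc: "{b, c} \<in> F" and "a \<noteq> c" and "\<not> universal b"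
  shows "{a, c} \<in> F"
proof (rule ccontr)
  assume ac: "{a, c} \<notin> F"
  have V: "a \<in> V" "b \<in> V" "c \<in> V" using ab bc edge_verts by auto
  have comps: "component a = component b" "component c = component b"
    using edge_component[OF ab] edge_component[OF bc] by auto
  have mem: "a \<in> component b" "b \<in> component b" "c \<in> component b"
    using comps V unfolding component_def by blast+
  obtain d where d: "d \<in> component b" "d \<noteq> b" "{d, b} \<notin> F"
    using assms(4) unfolding universal_def by blast
  define FC where "FC = {e \<in> F. e \<subseteq> component b}"
  obtain M where M: "matching FC M" "a \<notin> \<Union>M" "c \<notin> \<Union>M"
    and Mmax: "\<And>M'. matching FC M' \<Longrightarrow> card M' \<le> card M"
    unfolding FC_def by (rule missing_matching[OF V(2) mem(1,3) \<open>a \<noteq> c\<close> ac]) auto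
  obtain N where N: "matching FC N" "b \<notin> \<Union>N"
    and Nmax: "\<And>M'. matching FC M' \<Longrightarrow> card M' \<le> card N"
    unfolding FC_def by (rule missing_matching[OF V(2) d(1) mem(2) d(2,3)]) auto
  have "card N = card M" using Mmax[OF N(1)] Nmax[OF M(1)] by simp
  moreover have "finite FC" "\<And>e. e \<in> FC \<Longrightarrow> card e = 2" "{a, b} \<in> FC" "{b, c} \<in> FC"
    unfolding FC_def using finF edge_card ab bc mem by auto
  ultimately show False
    using max_matching_exchange[of FC "card M" a b c M N] Mmax \<open>a \<noteq> c\<close> M N by blast
qed

text \<open>Here \<open>p\<close> numbers the component, \<open>q\<close> the clique of a
  non-universal vertex, and \<open>a\<close> is the indicator of being non-universal. Real labels
  make adjacency algebraic, ready for a rank bound.\<close>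

lemma adjacency_labels:
  obtains p q a :: "'a \<Rightarrow> real"
  where "\<And>u v. u \<in> V \<Longrightarrow> v \<in> V \<Longrightarrow> u \<noteq> v \<Longrightarrow>
    {u, v} \<in> F \<longleftrightarrow> p u = p v \<and> a u * a v * (q u - q v) = 0"
proof -
  obtain h :: "'a set \<Rightarrow> nat" where h: "inj_on h (Pow V)"
    using finite_imp_inj_to_nat_seg[of "Pow V"] finV by auto
  have hiff: "real (h X) = real (h Y) \<longleftrightarrow> X = Y" if "X \<subseteq> V" "Y \<subseteq> V" for X Y
    using inj_on_eq_iff[OF h] that by simp
  \<comment> \<open>The closed neighbourhood among the non-universal vertices: including
    \<open>u\<close> itself makes it the same set for all members of a clique.\<close>
  define piece where "piece u = {w \<in> V. \<not> universal w \<and> (w = u \<or> {u, w} \<in> F)}" for u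
  have piece_iff: "piece u = piece v \<longleftrightarrow> {u, v} \<in> F"
    if "u \<in> V" "v \<in> V" "u \<noteq> v" "\<not> universal u" "\<not> universal v" for u v
  proof
    assume "piece u = piece v"
    then have "v \<in> piece u" using that by (simp add: piece_def)
    then show "{u, v} \<in> F" using that by (simp add: piece_def)
  next
    have sub: "piece x \<subseteq> piece y" if xy: "{x, y} \<in> F" "x \<in> V" "\<not> universal x" for x y
    proof
      fix w assume w: "w \<in> piece x"
      show "w \<in> piece y"
      proof (cases "w = y \<or> w = x")
        case True
        then show ?thesis using w xy by (auto simp: piece_def insert_commute)
      next
        case False
        then have "{y, w} \<in> F"
          using adjacency_transitive[of y x w] w xy by (auto simp: piece_def insert_commute)
        then show ?thesis using w by (simp add: piece_def)
      qed
    qed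
    assume "{u, v} \<in> F"
    then show "piece u = piece v" using sub[of u v] sub[of v u] that by (simp add: insert_commute)
  qed
  have "{u, v} \<in> F \<longleftrightarrow> real (h (component u)) = real (h (component v)) \<and>
      of_bool (\<not> universal u) * of_bool (\<not> universal v) * (real (h (piece u)) - real (h (piece v))) = 0"
    if uv: "u \<in> V" "v \<in> V" "u \<noteq> v" for u v
  proof -
    have comp: "real (h (component u)) = real (h (component v)) \<longleftrightarrow> component u = component v"
      by (intro hiff) (auto simp: component_def)
    have pc: "real (h (piece u)) - real (h (piece v)) = 0 \<longleftrightarrow> piece u = piece v"
      using hiff[of "piece u" "piece v"] by (auto simp: piece_def)
    have mem: "u \<in> component u" "v \<in> component v" using uv by (auto simp: component_def)
    have univ: "{u, v} \<in> F" if "component u = component v" "universal u \<or> universal v"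
      using that mem uv(3) unfolding universal_def by (metis insert_commute)
    show ?thesis
    proof (cases "universal u \<or> universal v")
      case True
      then show ?thesis using univ edge_component[of u v] comp by auto
    next
      case False
      then show ?thesis using piece_iff[OF uv] edge_component[of u v] comp pc by auto
    qed
  qed
  then show ?thesis by (rule that)
qed

end

lemma saturated_extension:
  assumes "simple_graph V G" "no_large_connected_matching V G t"
  obtains F where "G \<subseteq> F" "saturated_graph V F t"
proof -
  define Fs where "Fs = {F. F \<subseteq> complete_edges V \<and> no_large_connected_matching V F t}"
  have "finite Fs"
    using assms(1) by (intro finite_subset[of Fs "Pow (Pow V)"])
      (auto simp: Fs_def complete_edges_def simple_graph_def)
  moreover have "G \<in> Fs" using assms by (simp add: Fs_def simple_graph_def)
  ultimately obtain F where F: "F \<in> Fs" "G \<subseteq> F" "\<And>F'. F' \<in> Fs \<Longrightarrow> F \<subseteq> F' \<Longrightarrow> F = F'"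
    by (metis finite_has_maximal2)
  have "saturated_graph V F t"
  proof
    show "simple_graph V F" using assms(1) F(1) by (simp add: simple_graph_def Fs_def)
    show "no_large_connected_matching V F t" using F(1) by (simp add: Fs_def)
    show "\<not> no_large_connected_matching V (insert e F) t" if "e \<in> complete_edges V" "e \<notin> F" for e
    proof
      assume "no_large_connected_matching V (insert e F) t"
      then have "insert e F \<in> Fs" using that F(1) by (simp add: Fs_def)
      then show False using F(3)[of "insert e F"] that by auto
    qed
  qed
  then show ?thesis using that F(2) by blast
qed

section \<open>Rank bound and kernels of non-adjacency\<close>

text \<open>One elimination step: the rows that vanish at \<open>y\<^sub>0\<close> satisfy a linear relation, so
  on them the rank drops by one, at the cost of at most \<open>d\<close> discarded rows.\<close>

lemma nonzero_rows_le_rank: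
  fixes \<Phi> :: "'i \<Rightarrow> 'a \<Rightarrow> 'f::field" and \<Psi> :: "'i \<Rightarrow> 'b \<Rightarrow> 'f" and d :: real
  assumes "finite I" "finite X" "d \<ge> 0"
    and "\<And>y. y \<in> Y \<Longrightarrow> real (card {x \<in> X. (\<Sum>i\<in>I. \<Phi> i x * \<Psi> i y) \<noteq> 0}) \<le> d"
  shows "real (card {x \<in> X. \<exists>y\<in>Y. (\<Sum>i\<in>I. \<Phi> i x * \<Psi> i y) \<noteq> 0}) \<le> real (card I) * d"
  using assms
\<comment> \<open>Elimination changes \<open>\<Psi>\<close> and discards rows from \<open>X\<close>,
  while \<open>\<Phi>\<close>, \<open>Y\<close> and \<open>d\<close> stay fixed.\<close>
proof (induction "card I" arbitrary: I X \<Psi>)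
  case 0
  then show ?case by simp
next
  case (Suc r)
  note deg = Suc.prems(4)
  let ?g = "\<lambda>x y. \<Sum>i\<in>I. \<Phi> i x * \<Psi> i y"
  show ?case
  proof (cases "\<exists>x\<in>X. \<exists>y\<in>Y. ?g x y \<noteq> 0")
    case False
    then have "{x \<in> X. \<exists>y\<in>Y. ?g x y \<noteq> 0} = {}" by auto
    then show ?thesis using Suc.prems(3) by (simp only: card.empty) simp
  next
    case True
    then obtain x0 y0 where y0: "y0 \<in> Y" "?g x0 y0 \<noteq> 0" by auto
    then obtain j where j: "j \<in> I" "\<Psi> j y0 \<noteq> 0"
      by (metis (no_types, lifting) mult_zero_right sum.neutral)
    define X' where "X' = {x \<in> X. ?g x y0 = 0}"
    \<comment> \<open>A multiple of column \<open>y0\<close> is subtracted from column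
      \<open>y\<close>, scaled so that the coefficient at \<open>j\<close> vanishes. Column
      \<open>y0\<close> is zero on \<open>X'\<close>, so the entries there do not change although
      the index \<open>j\<close> disappears.\<close>
    define \<Psi>' where "\<Psi>' i y = \<Psi> i y - \<Psi> j y * \<Psi> i y0 / \<Psi> j y0" for i y
    have eq: "(\<Sum>i\<in>I - {j}. \<Phi> i x * \<Psi>' i y) = ?g x y" if "x \<in> X'" for x y
    proof -
      have "(\<Sum>i\<in>I. \<Phi> i x * \<Psi>' i y) = ?g x y - (\<Sum>i\<in>I. \<Phi> i x * \<Psi> i y0) * (\<Psi> j y / \<Psi> j y0)"
        unfolding \<Psi>'_def sum_distrib_right sum_subtractf[symmetric]
        by (intro sum.cong) (auto simp: algebra_simps)
      also have "\<dots> = ?g x y" using that by (simp add: X'_def)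
      finally have "(\<Sum>i\<in>I. \<Phi> i x * \<Psi>' i y) = ?g x y" .
      moreover have "\<Psi>' j y = 0" using j(2) by (simp add: \<Psi>'_def)
      ultimately show ?thesis
        using sum.remove[OF Suc.prems(1) j(1), of "\<lambda>i. \<Phi> i x * \<Psi>' i y"] by simp
    qed
    have card: "r = card (I - {j})" using Suc.hyps(2) j(1) Suc.prems(1) by simp
    have set_eq: "{x \<in> X'. P (\<lambda>y. \<Sum>i\<in>I - {j}. \<Phi> i x * \<Psi>' i y)} = {x \<in> X'. P (?g x)}" for P
      using eq by (auto cong: conj_cong)
    have finX': "finite X'" using Suc.prems(2) by (simp add: X'_def)
    have deg': "real (card {x \<in> X'. (\<Sum>i\<in>I - {j}. \<Phi> i x * \<Psi>' i y) \<noteq> 0}) \<le> d" if "y \<in> Y" for y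
    proof -
      have "card {x \<in> X'. ?g x y \<noteq> 0} \<le> card {x \<in> X. ?g x y \<noteq> 0}"
        using Suc.prems(2) by (intro card_mono) (auto simp: X'_def)
      then show ?thesis using deg[OF that] set_eq[of "\<lambda>g. g y \<noteq> 0"] by simp
    qed
    have "real (card {x \<in> X'. \<exists>y\<in>Y. (\<Sum>i\<in>I - {j}. \<Phi> i x * \<Psi>' i y) \<noteq> 0}) \<le> real (card (I - {j})) * d"
      using Suc.prems(1) by (intro Suc.hyps(1)[OF card _ finX' Suc.prems(3) deg']) auto
    then have IH: "real (card {x \<in> X'. \<exists>y\<in>Y. ?g x y \<noteq> 0}) \<le> real r * d"
      using card set_eq[of "\<lambda>g. \<exists>y\<in>Y. g y \<noteq> 0"] by simp
    have "{x \<in> X. \<exists>y\<in>Y. ?g x y \<noteq> 0} \<subseteq> {x \<in> X. ?g x y0 \<noteq> 0} \<union> {x \<in> X'. \<exists>y\<in>Y. ?g x y \<noteq> 0}"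
      by (auto simp: X'_def)
    then have "card {x \<in> X. \<exists>y\<in>Y. ?g x y \<noteq> 0}
        \<le> card ({x \<in> X. ?g x y0 \<noteq> 0} \<union> {x \<in> X'. \<exists>y\<in>Y. ?g x y \<noteq> 0})"
      using Suc.prems(2) finX' by (intro card_mono) auto
    also have "\<dots> \<le> card {x \<in> X. ?g x y0 \<noteq> 0} + card {x \<in> X'. \<exists>y\<in>Y. ?g x y \<noteq> 0}"
      by (rule card_Un_le)
    finally have "real (card {x \<in> X. \<exists>y\<in>Y. ?g x y \<noteq> 0}) \<le> d + real r * d"
      using IH deg[OF y0(1)] by linarith
    also have "\<dots> = real (card I) * d" using Suc.hyps(2)[symmetric] by (simp add: algebra_simps)
    finally show ?thesis .
  qed
qed

text \<open>Real and imaginary part encode the disjunction of the two ways of being non-adjacent;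
  the resulting complex kernel is a sum of four products.\<close>

lemma (in saturated_graph) nonadjacency_kernel:
  obtains \<phi> \<psi> :: "nat \<Rightarrow> 'a \<Rightarrow> complex"
  where "\<And>u v. u \<in> V \<Longrightarrow> v \<in> V \<Longrightarrow>
    (\<Sum>j<4. \<phi> j u * \<psi> j v) \<noteq> 0 \<longleftrightarrow> u \<noteq> v \<and> {u, v} \<notin> F"
proof -
  obtain p q a :: "'a \<Rightarrow> real"
    where lab: "\<And>u v. u \<in> V \<Longrightarrow> v \<in> V \<Longrightarrow> u \<noteq> v \<Longrightarrow>
      {u, v} \<in> F \<longleftrightarrow> p u = p v \<and> a u * a v * (q u - q v) = 0"
    by (rule adjacency_labels) auto
  \<comment> \<open>The four terms expand
    \<open>(p u - p v) + \<i> * a u * a v * (q u - q v)\<close>, which is also zero on the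
    diagonal.\<close>
  define \<phi> :: "nat \<Rightarrow> 'a \<Rightarrow> complex"
    where "\<phi> j u = [complex_of_real (p u), 1, \<i> * a u * q u, \<i> * a u] ! j" for j u
  define \<psi> :: "nat \<Rightarrow> 'a \<Rightarrow> complex"
    where "\<psi> j v = [1, - complex_of_real (p v), a v, - (a v * q v)] ! j" for j v
  have sum_eq: "(\<Sum>j<4. \<phi> j u * \<psi> j v) = Complex (p u - p v) (a u * a v * (q u - q v))" for u v
    by (simp add: \<phi>_def \<psi>_def eval_nat_numeral complex_eq_iff algebra_simps)
  have "(\<Sum>j<4. \<phi> j u * \<psi> j v) \<noteq> 0 \<longleftrightarrow> u \<noteq> v \<and> {u, v} \<notin> F" if "u \<in> V" "v \<in> V" for u v
    using lab[OF that] unfolding sum_eq complex_eq_iff by (cases "u = v") auto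
  then show ?thesis by (rule that)
qed

section \<open>Deleting uncovered vertices and completing the colouring\<close>

text \<open>The product of the kernels over \<open>L\<close> is nonzero exactly at the pairs
  adjacent in no \<open>F l\<close>; expanding it gives \<open>4 ^ card L\<close> terms, one for
  each choice function. An empty product would be 1 even on the diagonal, hence
  \<open>L \<noteq> {}\<close>.\<close>

lemma card_uncovered_vertices_le:
  fixes d :: real
  assumes "finite V" "finite L" "d \<ge> 0"
    and sat: "\<And>l. l \<in> L \<Longrightarrow> saturated_graph V (F l) t"
    and deg: "\<And>v. v \<in> V \<Longrightarrow> real (card {u \<in> V. u \<noteq> v \<and> (\<forall>l\<in>L. {u, v} \<notin> F l)}) \<le> d"
    and "L \<noteq> {}"
  shows "real (card {u \<in> V. \<exists>v\<in>V. u \<noteq> v \<and> (\<forall>l\<in>L. {u, v} \<notin> F l)}) \<le> 4 ^ card L * d"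
proof -
  have "\<forall>l\<in>L. \<exists>\<phi> \<psi> :: nat \<Rightarrow> 'a \<Rightarrow> complex. \<forall>u\<in>V. \<forall>v\<in>V.
      (\<Sum>j<4. \<phi> j u * \<psi> j v) \<noteq> 0 \<longleftrightarrow> u \<noteq> v \<and> {u, v} \<notin> F l"
    using saturated_graph.nonadjacency_kernel[OF sat] by metis
  then obtain \<phi> \<psi> :: "'b \<Rightarrow> nat \<Rightarrow> 'a \<Rightarrow> complex" where ker:
    "\<And>l u v. l \<in> L \<Longrightarrow> u \<in> V \<Longrightarrow> v \<in> V \<Longrightarrow>
      (\<Sum>j<4. \<phi> l j u * \<psi> l j v) \<noteq> 0 \<longleftrightarrow> u \<noteq> v \<and> {u, v} \<notin> F l"
    by metis
  define I where "I = (\<Pi>\<^sub>E l\<in>L. {..<4::nat})"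
  define \<Phi> where "\<Phi> f u = (\<Prod>l\<in>L. \<phi> l (f l) u)" for f u
  define \<Psi> where "\<Psi> f v = (\<Prod>l\<in>L. \<psi> l (f l) v)" for f v
  have finI: "finite I" unfolding I_def using assms(2) by (intro finite_PiE) auto
  have cardI: "card I = 4 ^ card L" unfolding I_def using assms(2) by (simp add: card_PiE)
  have "(\<Sum>f\<in>I. \<Phi> f u * \<Psi> f v) = (\<Prod>l\<in>L. \<Sum>j<4. \<phi> l j u * \<psi> l j v)" for u v
    unfolding I_def \<Phi>_def \<Psi>_def prod.distrib[symmetric]
    using assms(2) by (subst prod_sum_PiE) auto
  then have iff: "(\<Sum>f\<in>I. \<Phi> f u * \<Psi> f v) \<noteq> 0 \<longleftrightarrow> u \<noteq> v \<and> (\<forall>l\<in>L. {u, v} \<notin> F l)"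
    if "u \<in> V" "v \<in> V" for u v
    using ker that assms(2) \<open>L \<noteq> {}\<close> by (auto simp: prod_zero_iff)
  have "real (card {u \<in> V. \<exists>v\<in>V. (\<Sum>f\<in>I. \<Phi> f u * \<Psi> f v) \<noteq> 0}) \<le> real (card I) * d"
  proof (rule nonzero_rows_le_rank[OF finI assms(1,3)])
    fix v assume v: "v \<in> V"
    have "{u \<in> V. (\<Sum>f\<in>I. \<Phi> f u * \<Psi> f v) \<noteq> 0} = {u \<in> V. u \<noteq> v \<and> (\<forall>l\<in>L. {u, v} \<notin> F l)}"
      using iff v by blast
    then show "real (card {u \<in> V. (\<Sum>f\<in>I. \<Phi> f u * \<Psi> f v) \<noteq> 0}) \<le> d" using deg[OF v] by simp
  qed
  moreover have "{u \<in> V. \<exists>v\<in>V. (\<Sum>f\<in>I. \<Phi> f u * \<Psi> f v) \<noteq> 0}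
      = {u \<in> V. \<exists>v\<in>V. u \<noteq> v \<and> (\<forall>l\<in>L. {u, v} \<notin> F l)}"
    using iff by blast
  ultimately show ?thesis using cardI by simp
qed

text \<open>After the uncovered vertices are deleted, every pair lies in some \<open>F l\<close>, so
  the missing edges can be coloured without any colour class leaving its saturated graph.\<close>

lemma complete_colouring_exists:
  fixes d t :: real
  assumes "k > 0" "d \<ge> 0"
    and col: "coloured_graph k V E c"
    and size: "real (card V) \<ge> real N + 4 ^ k * d"
    and deg: "\<forall>v\<in>V. real (card (non_neighbours V E v)) \<le> d"
    and none: "\<not> has_mono_connected_matching V E c t"
  shows "\<exists>S c'. S \<subseteq> V \<and> card S = N \<and>
       coloured_graph k S (complete_edges S) c' \<and>
       \<not> has_mono_connected_matching S (complete_edges S) c' t \<and>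
       (\<forall>e\<in>E. e \<subseteq> S \<longrightarrow> c' e = c e)"
proof -
  have finV: "finite V" and E: "E \<subseteq> complete_edges V" and cE: "\<And>e. e \<in> E \<Longrightarrow> c e \<in> {1..k}"
    using col by (auto simp: coloured_graph_def simple_graph_def)
  \<comment> \<open>A monochromatic connected matching may have any natural number as its colour, so
    \<open>l\<close> is not restricted to \<open>{1..k}\<close>.\<close>
  have "\<exists>F. colour_class E c l \<subseteq> F \<and> saturated_graph V F t" for l
  proof -
    have "simple_graph V (colour_class E c l)"
      using finV E by (auto simp: simple_graph_def colour_class_def)
    moreover have "no_large_connected_matching V (colour_class E c l) t"
      using none unfolding no_large_connected_matching_def connected_matching_def
        has_mono_connected_matching_def mono_connected_matching_def by force
    ultimately show ?thesis using saturated_extension by metis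
  qed
  then obtain F where F: "\<And>l. colour_class E c l \<subseteq> F l" "\<And>l. saturated_graph V (F l) t"
    by metis
  define B where "B = {u \<in> V. \<exists>v\<in>V. u \<noteq> v \<and> (\<forall>l\<in>{1..k}. {u, v} \<notin> F l)}"
  have E_F: "e \<in> F (c e)" if "e \<in> E" for e
    using F(1) that by (auto simp: colour_class_def)
  have "real (card {u \<in> V. u \<noteq> v \<and> (\<forall>l\<in>{1..k}. {u, v} \<notin> F l)}) \<le> d" if v: "v \<in> V" for v
  proof -
    \<comment> \<open>An edge \<open>e\<close> of the given graph lies in \<open>F (c e)\<close>, so
      every uncovered pair is a non-edge.\<close>
    have "card {u \<in> V. u \<noteq> v \<and> (\<forall>l\<in>{1..k}. {u, v} \<notin> F l)} \<le> card (non_neighbours V E v)"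
      using finV E_F cE unfolding non_neighbours_def by (intro card_mono) (simp, blast)
    then show ?thesis using deg v by (meson of_nat_le_iff order_trans)
  qed
  then have "real (card B) \<le> 4 ^ k * d"
    using card_uncovered_vertices_le[of V "{1..k}" d F t] finV assms(1,2) F(2) unfolding B_def by simp
  then have "N \<le> card (V - B)"
    using size finV card_Diff_subset[of B V] card_mono[of V B] by (auto simp: B_def)
  then obtain S where S: "S \<subseteq> V - B" "card S = N" using obtain_subset_with_card_n by metis
  have finS: "finite S" using S(1) finV by (meson finite_Diff finite_subset)
  \<comment> \<open>Existing edges keep their colour, as the induced subgraph clause demands; a
    missing pair takes any colour whose saturated graph contains it.\<close>
  define c' where "c' e = (if e \<in> E then c e else SOME l. l \<in> {1..k} \<and> e \<in> F l)" for e
  have c': "c' e \<in> {1..k} \<and> e \<in> F (c' e)" if e: "e \<in> complete_edges S" for e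
  proof (cases "e \<in> E")
    case True
    then show ?thesis using cE E_F by (simp add: c'_def)
  next
    case False
    obtain u v where uv: "e = {u, v}" "u \<noteq> v" "u \<in> S" "v \<in> S"
      using e unfolding complete_edges_def card_2_iff by auto
    then have "\<exists>l. l \<in> {1..k} \<and> e \<in> F l" using S(1) unfolding B_def by blast
    from someI_ex[OF this] show ?thesis using False by (simp add: c'_def)
  qed
  have "\<not> has_mono_connected_matching S (complete_edges S) c' t"
  proof
    assume "has_mono_connected_matching S (complete_edges S) c' t"
    then obtain M l where M: "connected_matching S (colour_class (complete_edges S) c' l) M"
      "real (card (\<Union>M)) \<ge> t"
      unfolding has_mono_connected_matching_def mono_connected_matching_def connected_matching_def by auto
    have "colour_class (complete_edges S) c' l \<subseteq> F l" using c' by (auto simp: colour_class_def)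
    then have "connected_matching V (F l) M" using connected_matching_mono[OF M(1)] S(1) by blast
    then show False
      using saturated_graph.no_large[OF F(2)] M(2) unfolding no_large_connected_matching_def by force
  qed
  moreover have "coloured_graph k S (complete_edges S) c'"
    using finS c' by (auto simp: coloured_graph_def simple_graph_def)
  ultimately show ?thesis using S by (intro exI[of _ S] exI[of _ c']) (auto simp: c'_def)
qed

section \<open>The numerical estimate for the deleted vertices\<close>

theorem theorem2p1:
  fixes k :: nat and \<alpha> \<beta> :: real
  assumes "k > 0" and "\<alpha> > 0" and "\<beta> \<ge> \<alpha>"
  shows "\<exists>\<epsilon>\<^sub>0>0. \<forall>(\<epsilon>::real) (\<delta>::real) (n::real) (N::nat) (V::'a set) E c.
    0 < \<epsilon> \<longrightarrow> \<epsilon> \<le> \<epsilon>\<^sub>0 \<longrightarrow> \<delta> = \<epsilon> / 2 * (\<alpha> / (16 * \<beta>)) ^ (2 * k) \<longrightarrow>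
    n > 0 \<longrightarrow> N > 0 \<longrightarrow> real N \<le> \<beta> * n \<longrightarrow>
    coloured_graph k V E c \<longrightarrow>
    real (card V) \<ge> real N + \<epsilon> * n \<longrightarrow>
    (\<forall>v\<in>V. real (card (non_neighbours V E v)) \<le> \<delta> * n) \<longrightarrow>
    \<not> has_mono_connected_matching V E c (\<alpha> * n) \<longrightarrow>
    (\<exists>S c'. S \<subseteq> V \<and> card S = N \<and>
       coloured_graph k S (complete_edges S) c' \<and>
       \<not> has_mono_connected_matching S (complete_edges S) c' (\<alpha> * n) \<and>
       (\<forall>e\<in>E. e \<subseteq> S \<longrightarrow> c' e = c e))"
proof -
  \<comment> \<open>From \<alpha> \<le> \<beta> follows
    \<open>\<theta> \<le> (1 / 16) ^ (2 * k)\<close>, so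
    \<open>4 ^ k * \<theta> \<le> (1 / 64) ^ k \<le> 1\<close>. At most
    \<open>\<epsilon> / 2 * n\<close> vertices are therefore deleted, within the surplus
    \<open>\<epsilon> * n\<close>.\<close>
  define \<theta> where "\<theta> = (\<alpha> / (16 * \<beta>)) ^ (2 * k)"
  have "\<alpha> / (16 * \<beta>) \<le> 1 / 16" using assms by (simp add: field_simps)
  then have "\<theta> \<le> (1 / 16) ^ (2 * k)"
    unfolding \<theta>_def using assms by (intro power_mono) auto
  then have "4 ^ k * \<theta> \<le> 4 ^ k * (1 / 16) ^ (2 * k)" by simp
  also have "\<dots> = (1 / 64) ^ k"
    by (simp add: power_mult power_mult_distrib[symmetric] power2_eq_square)
  also have "\<dots> \<le> 1" by (simp add: power_le_one)
  finally have \<theta>: "4 ^ k * \<theta> \<le> 1" .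
  have \<theta>0: "\<theta> \<ge> 0" unfolding \<theta>_def using assms by simp
  show ?thesis
  proof (intro exI[of _ 1] conjI allI impI, goal_cases)
    case 1
    then show ?case by simp
  next
    case (2 \<epsilon> \<delta> n N V E c)
    have \<delta>: "\<delta> = \<epsilon> / 2 * \<theta>" using 2(3) by (simp add: \<theta>_def)
    have "4 ^ k * (\<delta> * n) = (\<epsilon> / 2 * n) * (4 ^ k * \<theta>)" by (simp add: \<delta>)
    also have "\<dots> \<le> (\<epsilon> / 2 * n) * 1" using 2(1,4) \<theta> by (intro mult_left_mono) auto
    also have "\<dots> \<le> \<epsilon> * n" using 2(1,4) by simp
    finally have "real (card V) \<ge> real N + 4 ^ k * (\<delta> * n)" using 2(8) by simp
    moreover have "\<delta> * n \<ge> 0" unfolding \<delta> using \<theta>0 2(1,4) by simp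
    ultimately show ?case
      using complete_colouring_exists[where d = "\<delta> * n"] assms(1) 2 by blast
  qed
qed

end
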